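(* There exists $P>0$ such that for all real $p>P$ and all real $a$ satisfying $$a>\frac{p}{2\pi e}+\frac{1}{4\pi e}\log p+1,$$ one has $\zeta(-p,a)<0$.
   Context: For real $a>0$ (all positive $a$ are allowed, not only $0<a\le 1$), $\zeta(s,a)$ denotes the Hurwitz zeta-function: the analytic continuation in $s$ to $\mathbb{C}\setminus\{1\}$ of $\sum_{r=0}^{\infty}(a+r)^{-s}$, which converges for $\mathrm{Re}(s)>1$. Here $\log$ is the natural logarithm. *)

theory Defs
  imports "HOL-Complex_Analysis.Complex_Analysis"
begin

text \<open>
  For \<open>a > 0\<close>, \<open>is_hurwitz_continuation a f\<close> says that \<open>f\<close> is the analytic continuation to
  \<open>\<complex> - {1}\<close> of the Hurwitz series. The value at the pole \<open>s = 1\<close> is pinned to the dummy value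
  \<open>0\<close> only so that \<open>f\<close> is determined as a total function.
\<close>

definition is_hurwitz_continuation :: "real \<Rightarrow> (complex \<Rightarrow> complex) \<Rightarrow> bool" where
  "is_hurwitz_continuation a f \<longleftrightarrow>
     f holomorphic_on (- {1}) \<and>
     (\<forall>s. Re s > 1 \<longrightarrow> (\<lambda>r. complex_of_real (a + real r) powr (- s)) sums f s) \<and>
     f 1 = 0"

definition hurwitz_zeta :: "complex \<Rightarrow> real \<Rightarrow> complex" where
  "hurwitz_zeta s a = (THE f. is_hurwitz_continuation a f) s"

lemma is_hurwitz_continuation_unique:
  assumes f: "is_hurwitz_continuation a f" and g: "is_hurwitz_continuation a g"
  shows "f = g"
proof
  fix s :: complex
  have conn: "connected (- {1::complex})"
    by (rule connected_punctured_universe) simp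
  have op: "open {z. Re z > 1}"
    by (rule open_halfspace_Re_gt)
  have eq: "f z = g z" if "z \<in> {z. Re z > 1}" for z
    using f g that unfolding is_hurwitz_continuation_def by (metis mem_Collect_eq sums_unique2)
  show "f s = g s"
  proof (cases "s = 1")
    case True
    with f g show ?thesis by (simp add: is_hurwitz_continuation_def)
  next
    case False
    have "2 \<in> {z::complex. Re z > 1}" by simp
    then have ne: "{z::complex. Re z > 1} \<noteq> {}" by blast
    show ?thesis
      by (rule analytic_continuation_open[OF op _ ne conn _ _ _ eq])
         (use f g False in \<open>auto simp: is_hurwitz_continuation_def\<close>)
  qed
qed

lemma hurwitz_zeta_eqI: "is_hurwitz_continuation a f \<Longrightarrow> hurwitz_zeta s a = f s"
  unfolding hurwitz_zeta_def by (metis is_hurwitz_continuation_unique the_equality)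

end

theory Submission
  imports Defs "HOL-Real_Asymp.Real_Asymp"
begin

text \<open>
  Let \<open>a = a\<^sub>0 + N\<close> with \<open>1 \<le> a\<^sub>0 < 2\<close>. Removing \<open>N\<close> terms from the series gives
  \<open>\<zeta>(-p, a) = \<zeta>(-p, a\<^sub>0) - (\<Sum>r<N. (a\<^sub>0 + r)\<^sup>p)\<close>, and the sum is at least its last term \<open>(a - 1)\<^sup>p\<close>. So it is
  enough that \<open>(a - 1)\<^sup>p\<close> exceeds \<open>\<bar>\<zeta>(-p, a\<^sub>0)\<bar>\<close>. For \<open>a\<^sub>0\<close> in a bounded range that number is at most about
  \<open>2 \<Gamma>(p + 1) / (2\<pi>)\<^bsup>p + 1\<^esup>\<close>, which by Stirling's formula is about
  \<open>\<surd>(2/\<pi>) \<surd>p (p / (2\<pi>e))\<^sup>p\<close>. On the other side, \<open>a - 1 > (p / (2\<pi>e)) (1 + ln p / (2p))\<close> and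
  \<open>(1 + ln p / (2p))\<^sup>p\<close> is asymptotic to \<open>\<surd>p\<close>. Since \<open>\<surd>(2/\<pi>) < 1\<close>, the last term wins for large \<open>p\<close>. The
  slack in this inequality leaves room for a crude form of Stirling's bound
  (\<open>Gamma_le_Stirling\<close>), with \<open>exp(11/10) < \<pi>\<close> in place of \<open>\<surd>(2\<pi>)\<close>.

  The continuation and its size both come from the representation
  \<open>\<zeta>(s, c + 1/2) = (s - 1)\<^sup>-\<^sup>1 \<integral> (c + i x)\<^bsup>1 - s\<^esup> \<sqdot> \<pi> / (2 cosh\<^sup>2(\<pi> x)) dx\<close> over the real line, for \<open>c > 0\<close>
  (\<open>hurwitz_zeta_conv_sech_mean\<close>). The integral is entire in \<open>s\<close>. Along the line \<open>Re z = c\<close> the kernel is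
  a multiple of \<open>sec\<^sup>2(\<pi>(z - c))\<close>, which is periodic under \<open>z \<mapsto> z + 1\<close>; hence replacing \<open>c\<close> by \<open>c + 1\<close>
  changes the integral by a residue at \<open>c + 1/2\<close>, and this residue is exactly the term \<open>(c + 1/2)\<^bsup>-s\<^esup>\<close>
  (\<open>vertical_mean_difference\<close>). Telescoping for \<open>Re s > 1\<close> yields the Hurwitz series. At \<open>s = -p\<close> the
  kernel is at most \<open>2\<pi> exp(-2\<pi>\<bar>x\<bar>)\<close>, so the integral is controlled by Euler's integral for the Gamma
  function (\<open>norm_hurwitz_zeta_le\<close>).
\<close>

section \<open>Integrals over the real line\<close>

text \<open>
  Euler's integral with the rate \<open>b\<close> scaled in.
\<close>
lemma has_bochner_integral_Gamma:
  fixes q b :: real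
  assumes "q > -1" "b > 0"
  shows "has_bochner_integral lborel (\<lambda>y. indicator {0..} y * (y powr q * exp (-(b*y))))
           (Gamma (q + 1) / b powr (q + 1))"
proof -
  let ?f = "\<lambda>t::real. indicator {0..} t * t powr (q + 1 - 1) / exp t"
  have "has_bochner_integral lborel ?f (Gamma (q + 1))"
    using assms Gamma_conv_nn_integral_real[of "q + 1"]
    by (intro has_bochner_integral_nn_integral) (auto intro!: Gamma_real_nonneg)
  then have "has_bochner_integral lborel (\<lambda>x. ?f (0 + b * x)) (Gamma (q + 1) /\<^sub>R \<bar>b\<bar>)"
    using assms by (subst (asm) lborel_has_bochner_integral_real_affine_iff[of b _ _ 0]) auto
  then have "has_bochner_integral lborel (\<lambda>x. b powr (-q) * ?f (0 + b * x)) (b powr (-q) * (Gamma (q + 1) /\<^sub>R \<bar>b\<bar>))"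
    by (rule has_bochner_integral_mult_right)
  also have "b powr (-q) * (Gamma (q + 1) /\<^sub>R \<bar>b\<bar>) = Gamma (q + 1) / b powr (q + 1)"
    using assms by (simp add: powr_minus powr_add field_simps)
  also have "(\<lambda>x. b powr (-q) * ?f (0 + b * x)) = (\<lambda>y. indicator {0..} y * (y powr q * exp (-(b*y))))"
    using assms by (auto simp: fun_eq_iff indicator_def powr_mult powr_minus exp_minus field_simps zero_le_mult_iff)
  finally show ?thesis .
qed

lemma has_bochner_integral_even:
  fixes f :: "real \<Rightarrow> real"
  assumes "has_bochner_integral lborel (\<lambda>x. indicator {0..} x * f x) I"
  shows   "has_bochner_integral lborel (\<lambda>x. f \<bar>x\<bar>) (2 * I)"
proof -
  let ?g = "\<lambda>x. indicator {0..} x * f x"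
  have "has_bochner_integral lborel (\<lambda>x. ?g (0 + (-1) * x)) (I /\<^sub>R \<bar>-1\<bar>)"
    using assms by (subst (asm) lborel_has_bochner_integral_real_affine_iff[of "-1" _ _ 0]) auto
  from has_bochner_integral_add[OF assms this]
  have sum: "has_bochner_integral lborel (\<lambda>x. ?g x + ?g (-x)) (2 * I)" by simp
  have "AE x in lborel. x \<noteq> (0::real)" by (rule AE_lborel_singleton)
  then have ae: "AE x in lborel. ?g x + ?g (-x) = f \<bar>x\<bar>"
    by eventually_elim (auto simp: indicator_def)
  have [measurable]: "?g \<in> borel_measurable lborel"
    using assms by (rule borel_measurable_has_bochner_integral)
  have "(\<lambda>x. ?g \<bar>x\<bar>) \<in> borel_measurable lborel" by measurable
  moreover have "(\<lambda>x. ?g \<bar>x\<bar>) = (\<lambda>x. f \<bar>x\<bar>)" by auto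
  ultimately have "(\<lambda>x. f \<bar>x\<bar>) \<in> borel_measurable lborel" by simp
  from has_bochner_integralI_AE[OF sum this] ae show ?thesis by auto
qed

lemma integrable_exp_minus_abs: "integrable lborel (\<lambda>x::real. exp (-\<bar>x\<bar>))"
proof -
  have *: "has_bochner_integral lborel (\<lambda>x::real. indicator {0..} x * (x powr 0 * exp (-(1*x)))) (Gamma (0 + 1) / 1 powr (0+1))"
    by (rule has_bochner_integral_Gamma) auto
  have ae: "AE x in lborel. x \<noteq> (0::real)" by (rule AE_lborel_singleton)
  have "integrable lborel (\<lambda>x::real. \<bar>x\<bar> powr 0 * exp (-(1*\<bar>x\<bar>)))"
    using has_bochner_integral_even[OF *] by (simp add: has_bochner_integral_iff)
  then show ?thesis
    by (rule Bochner_Integration.integrable_cong_AE_imp) (use ae in \<open>auto elim: eventually_mono\<close>)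
qed

lemma tendsto_integral_symmetric_interval:
  fixes f :: "real \<Rightarrow> 'a::euclidean_space"
  assumes f: "integrable lborel f"
  shows "(\<lambda>n. integral {-real n..real n} f) \<longlonglongrightarrow> (LINT x|lborel. f x)"
proof -
  have [measurable]: "f \<in> borel_measurable borel" using f by auto
  have "(\<lambda>n. LINT x|lborel. indicator {-real n..real n} x *\<^sub>R f x) \<longlonglongrightarrow> (LINT x|lborel. f x)"
  proof (rule integral_dominated_convergence[where w = "\<lambda>x. norm (f x)"])
    show "AE x in lborel. (\<lambda>n. indicator {-real n..real n} x *\<^sub>R f x) \<longlonglongrightarrow> f x"
    proof (rule AE_I2)
      fix x :: real
      have "eventually (\<lambda>n. \<bar>x\<bar> \<le> real n) sequentially"
        using filterlim_real_sequentially unfolding filterlim_at_top by blast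
      then show "(\<lambda>n. indicator {-real n..real n} x *\<^sub>R f x) \<longlonglongrightarrow> f x"
        by (intro tendsto_eventually eventually_mono[OF \<open>eventually (\<lambda>n. \<bar>x\<bar> \<le> real n) sequentially\<close>])
           (auto simp: indicator_def)
    qed
  qed (use f in \<open>auto split: split_indicator\<close>)
  moreover have "(LINT x|lborel. indicator {-real n..real n} x *\<^sub>R f x) = integral {-real n..real n} f" for n
    using set_borel_integral_eq_integral(2)[of "{-real n..real n}" f] f
    by (simp add: set_integrable_def set_lebesgue_integral_def integrable_mult_indicator)
  ultimately show ?thesis by simp
qed

text \<open>
  The error bound depends only on the dominating function, so truncation is uniform over a family
  of integrands with a common bound. This gives the locally uniform convergence needed for
  holomorphy in a parameter.
\<close>
lemma integral_symmetric_interval_error: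
  fixes f :: "real \<Rightarrow> 'a::euclidean_space"
  assumes f: "integrable lborel f" and g: "integrable lborel g" and le: "\<And>x. norm (f x) \<le> g x"
  shows "norm ((LINT x|lborel. f x) - integral {-real n..real n} f) \<le>
           (LINT x|lborel. g x) - integral {-real n..real n} g"
proof -
  define A where "A = {-real n..real n}"
  have *: "(LINT x|lborel. h x) - integral A h = (LINT x|lborel. indicator (-A) x *\<^sub>R h x)"
    if h: "integrable lborel h" for h :: "real \<Rightarrow> 'b::euclidean_space"
  proof -
    have "integral A h = (LINT x|lborel. indicator A x *\<^sub>R h x)"
      using set_borel_integral_eq_integral(2)[of A h] h
      by (simp add: set_integrable_def set_lebesgue_integral_def integrable_mult_indicator A_def)
    also have "(LINT x|lborel. h x) - \<dots> = (LINT x|lborel. h x - indicator A x *\<^sub>R h x)"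
      by (rule Bochner_Integration.integral_diff[symmetric])
         (use h in \<open>auto intro!: integrable_mult_indicator simp: A_def\<close>)
    also have "\<dots> = (LINT x|lborel. indicator (-A) x *\<^sub>R h x)"
      by (intro Bochner_Integration.integral_cong) (auto split: split_indicator)
    finally show ?thesis .
  qed
  have "norm (LINT x|lborel. indicator (-A) x *\<^sub>R f x) \<le> (LINT x|lborel. indicator (-A) x *\<^sub>R g x)"
    by (rule Bochner_Integration.integral_norm_bound_integral)
       (use f g le integrable_mult_indicator[OF _ f, of "-A"] integrable_mult_indicator[OF _ g, of "-A"]
         in \<open>auto simp: A_def split: split_indicator\<close>)
  then show ?thesis
    using *[OF f] *[OF g] unfolding A_def by simp
qed

text \<open>
  The substitution \<open>y = \<bar>x\<bar> + \<epsilon>\<close> gives a piece of Euler's integral, at the price of the factor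
  \<open>exp(b \<epsilon>)\<close>.
\<close>
lemma integral_shifted_Gamma_le:
  fixes q b \<epsilon> :: real
  assumes "q > -1" "b > 0" "\<epsilon> \<ge> 0"
  shows "integrable lborel (\<lambda>x. exp (-(b * \<bar>x\<bar>)) * (\<bar>x\<bar> + \<epsilon>) powr q)"
    and "(LINT x|lborel. exp (-(b * \<bar>x\<bar>)) * (\<bar>x\<bar> + \<epsilon>) powr q) \<le> 2 * exp (b * \<epsilon>) * Gamma (q + 1) / b powr (q + 1)"
proof -
  define h where "h = (\<lambda>y. indicator {0..} y * (y powr q * exp (-(b*y))))"
  define k where "k = (\<lambda>x. exp (-(b * x)) * (x + \<epsilon>) powr q)"
  have h: "has_bochner_integral lborel h (Gamma (q + 1) / b powr (q + 1))"
    unfolding h_def using assms by (intro has_bochner_integral_Gamma)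
  have hs: "has_bochner_integral lborel (\<lambda>x. exp (b * \<epsilon>) * h (\<epsilon> + 1 * x)) (exp (b * \<epsilon>) * (Gamma (q + 1) / b powr (q + 1)))"
    using h by (intro has_bochner_integral_mult_right)
               (subst (asm) lborel_has_bochner_integral_real_affine_iff[of 1 _ _ \<epsilon>], auto)
  have le: "indicator {0..} x * k x \<le> exp (b * \<epsilon>) * h (\<epsilon> + 1 * x)" for x
    using assms by (auto simp: indicator_def h_def k_def algebra_simps exp_add exp_diff exp_minus field_simps)
  have k0: "indicator {0..} x * k x \<ge> 0" for x by (auto simp: k_def indicator_def)
  have intk: "integrable lborel (\<lambda>x. indicator {0..} x * k x)"
  proof (rule Bochner_Integration.integrable_bound)
    show "integrable lborel (\<lambda>x. exp (b * \<epsilon>) * h (\<epsilon> + 1 * x))"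
      using hs by (simp add: has_bochner_integral_iff)
    show "AE x in lborel. norm (indicator {0..} x * k x) \<le> norm (exp (b * \<epsilon>) * h (\<epsilon> + 1 * x))"
      using le k0 by (intro AE_I2) (smt (verit) real_norm_def)
  qed (simp add: k_def)
  have "(LINT x|lborel. indicator {0..} x * k x) \<le> (LINT x|lborel. exp (b * \<epsilon>) * h (\<epsilon> + 1 * x))"
    using hs by (intro integral_mono intk le) (simp add: has_bochner_integral_iff)
  also have "\<dots> = exp (b * \<epsilon>) * (Gamma (q + 1) / b powr (q + 1))"
    using hs by (simp add: has_bochner_integral_iff)
  finally have J: "(LINT x|lborel. indicator {0..} x * k x) \<le> exp (b * \<epsilon>) * (Gamma (q + 1) / b powr (q + 1))" .
  have "has_bochner_integral lborel (\<lambda>x. indicator {0..} x * k x) (LINT x|lborel. indicator {0..} x * k x)"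
    using intk by (rule has_bochner_integral_integrable)
  then have "has_bochner_integral lborel (\<lambda>x. k \<bar>x\<bar>) (2 * (LINT x|lborel. indicator {0..} x * k x))"
    by (rule has_bochner_integral_even)
  then show "integrable lborel (\<lambda>x. exp (-(b * \<bar>x\<bar>)) * (\<bar>x\<bar> + \<epsilon>) powr q)"
    and "(LINT x|lborel. exp (-(b * \<bar>x\<bar>)) * (\<bar>x\<bar> + \<epsilon>) powr q) \<le> 2 * exp (b * \<epsilon>) * Gamma (q + 1) / b powr (q + 1)"
    using J by (simp_all add: has_bochner_integral_iff k_def)
qed

section \<open>The squared hyperbolic secant as a kernel\<close>

text \<open>
  The constant makes the integral over the line equal to \<open>1\<close>. Up to that constant this is
  \<open>sec\<^sup>2(\<pi>(z - c))\<close> on the line \<open>Re z = c\<close>, and the secant has period \<open>1\<close> up to sign: shifting the line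
  by \<open>1\<close> leaves the kernel unchanged. Its decay rate \<open>2\<pi>\<close> is where the powers of \<open>2\<pi>\<close> in the bound for
  \<open>\<zeta>(-p, a)\<close> come from.
\<close>
definition sech_kernel :: "real \<Rightarrow> real" where
  "sech_kernel x = pi / (2 * cosh (pi * x) ^ 2)"

lemma sech_kernel_nonneg: "sech_kernel x \<ge> 0"
  by (simp add: sech_kernel_def)

lemma sech_kernel_minus [simp]: "sech_kernel (-x) = sech_kernel x"
  by (simp add: sech_kernel_def)

lemma continuous_on_sech_kernel [continuous_intros]:
  "continuous_on A f \<Longrightarrow> continuous_on A (\<lambda>x. sech_kernel (f x))"
  unfolding sech_kernel_def by (intro continuous_intros) auto

lemma sech_kernel_le: "sech_kernel x \<le> 2 * pi * exp (-(2 * pi * \<bar>x\<bar>))"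
proof -
  have "exp (pi * \<bar>x\<bar>) / 2 \<le> cosh (pi * \<bar>x\<bar>)"
    by (simp add: cosh_field_def)
  also have "cosh (pi * \<bar>x\<bar>) = cosh (pi * x)"
    by (metis abs_mult abs_of_nonneg cosh_real_abs pi_ge_zero)
  finally have "(exp (pi * \<bar>x\<bar>) / 2) ^ 2 \<le> cosh (pi * x) ^ 2"
    by (intro power_mono) auto
  then have "pi / (2 * cosh (pi * x) ^ 2) \<le> pi / (2 * (exp (pi * \<bar>x\<bar>) / 2) ^ 2)"
    by (intro divide_left_mono mult_left_mono mult_pos_pos) auto
  also have "\<dots> = 2 * pi * exp (-(2 * pi * \<bar>x\<bar>))"
    by (simp add: power_divide exp_minus inverse_eq_divide mult.assoc exp_double)
  finally show ?thesis by (simp add: sech_kernel_def)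
qed

text \<open>
  Any growth rate below \<open>2\<pi>\<close> would be absorbed by the kernel; rate \<open>1\<close> is enough, because powers
  \<open>(c + i x)\<^sup>w\<close> grow only polynomially.
\<close>
lemma sech_kernel_dominated:
  fixes v :: "'a::real_normed_vector"
  assumes "norm v \<le> B * exp \<bar>x\<bar>"
  shows "norm (sech_kernel x *\<^sub>R v) \<le> 2 * pi * B * exp (-\<bar>x\<bar>)"
proof -
  have "B * exp \<bar>x\<bar> \<ge> 0" using assms norm_ge_zero order_trans by blast
  then have B: "B \<ge> 0" by (simp add: zero_le_mult_iff)
  have "norm (sech_kernel x *\<^sub>R v) \<le> (2 * pi * exp (-(2 * pi * \<bar>x\<bar>))) * (B * exp \<bar>x\<bar>)"
    using sech_kernel_le[of x] sech_kernel_nonneg[of x] assms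
    by (simp only: norm_scaleR abs_of_nonneg) (intro mult_mono, auto)
  also have "\<dots> = 2 * pi * B * exp (\<bar>x\<bar> - 2 * pi * \<bar>x\<bar>)"
    by (simp add: exp_diff exp_minus field_simps)
  also have "\<dots> \<le> 2 * pi * B * exp (-\<bar>x\<bar>)"
  proof -
    have "2 * \<bar>x\<bar> \<le> 2 * pi * \<bar>x\<bar>" using pi_gt3 by (intro mult_right_mono) auto
    then show ?thesis using B by (intro mult_left_mono) auto
  qed
  finally show ?thesis .
qed

lemma integrable_sech_kernel:
  fixes h :: "real \<Rightarrow> complex"
  assumes "continuous_on UNIV h" "\<And>x. norm (h x) \<le> B * exp \<bar>x\<bar>"
  shows "integrable lborel (\<lambda>x. sech_kernel x *\<^sub>R h x)"
proof (rule Bochner_Integration.integrable_bound)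
  show "integrable lborel (\<lambda>x::real. 2 * pi * B * exp (-\<bar>x\<bar>))"
    using integrable_exp_minus_abs by simp
  have "continuous_on UNIV (\<lambda>x. sech_kernel x *\<^sub>R h x)"
    by (intro continuous_intros assms)
  then show "(\<lambda>x. sech_kernel x *\<^sub>R h x) \<in> borel_measurable lborel"
    by (simp add: borel_measurable_continuous_onI)
  have "norm (sech_kernel x *\<^sub>R h x) \<le> norm (2 * pi * B * exp (-\<bar>x\<bar>))" for x
    using sech_kernel_dominated[OF assms(2)[of x]] by (rule order_trans) simp
  then show "AE x in lborel. norm (sech_kernel x *\<^sub>R h x) \<le> norm (2 * pi * B * exp (-\<bar>x\<bar>))"
    by simp
qed

section \<open>Shifting a vertical line by one period\<close>

lemma cos_vertical: "cos (of_real pi * (Complex c x - of_real c)) = of_real (cosh (pi * x))"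
proof -
  have "of_real pi * (Complex c x - of_real c) = \<i> * of_real (pi * x)"
    by (simp add: complex_eq_iff)
  then have "cos (of_real pi * (Complex c x - of_real c)) = cosh (complex_of_real (pi * x))"
    by (simp only: cosh_conv_cos)
  also have "\<dots> = of_real (cosh (pi * x))"
    by (simp add: cosh_field_def exp_of_real exp_minus del: of_real_mult)
  finally show ?thesis .
qed

text \<open>
  Closing up the interval at either end would admit the neighbouring zeros of the cosine; with the
  open strip of width \<open>2\<close> the secant kernel below has just one pole.
\<close>
lemma cos_zero_in_strip:
  fixes z :: complex and c :: real
  assumes "cos (of_real pi * (z - of_real c)) = 0" "c - 1/2 < Re z" "Re z < c + 3/2"
  shows   "z = of_real (c + 1/2)"
proof -
  obtain n :: int where n: "of_real pi * (z - of_real c) = of_real (n * pi) + of_real pi / 2"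
    using assms(1) unfolding cos_eq_0 by blast
  have "of_real pi * (z - of_real c) = of_real pi * of_real (of_int n + 1/2)"
    using n by (simp add: algebra_simps)
  then have "z - of_real c = of_real (of_int n + 1/2)"
    by (subst (asm) mult_cancel_left) simp
  then have z: "z = of_real (c + (of_int n + 1/2))"
    by (simp add: algebra_simps)
  with assms(2,3) have "-1 < real_of_int n" "real_of_int n < 1" by auto
  then have "n = 0" by linarith
  with z show ?thesis by simp
qed

lemma norm_cos_ge:
  fixes z :: complex
  shows "\<bar>sinh (Im z)\<bar> \<le> norm (cos z)"
proof -
  have "\<bar>sinh (Im z)\<bar> ^ 2 \<le> norm (cos z) ^ 2"
    unfolding norm_cos_squared by (simp add: sinh_field_def exp_minus power_divide)
  then show ?thesis by (rule power2_le_imp_le) simp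
qed

text \<open>
  The integrand has a double pole at \<open>c + 1/2\<close>. Subtracting the exact differential of
  \<open>G(z) tan(\<pi>(z - c)) / \<pi>\<close> leaves \<open>- G'(z) tan(\<pi>(z - c)) / \<pi>\<close>, whose pole is simple, so only the
  residue \<open>-1/\<pi>\<close> of the tangent enters.
\<close>
lemma contour_integral_rectangle_sec_squared:
  fixes G :: "complex \<Rightarrow> complex" and b c T :: real
  assumes G: "G holomorphic_on {z. b < Re z}" and "b < c" "T > 0"
  shows "contour_integral (rectpath (Complex c (-T)) (Complex (c+1) T))
           (\<lambda>z. G z / cos (of_real pi * (z - of_real c)) ^ 2) =
         2 * \<i> * deriv G (of_real (c + 1/2)) / of_real pi" (is "contour_integral ?\<gamma> ?f = _")
proof -
  define z0 :: complex where "z0 = of_real (c + 1/2)"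
  define C where "C = (\<lambda>z::complex. cos (of_real pi * (z - of_real c)))"
  define S where "S = (\<lambda>z::complex. sin (of_real pi * (z - of_real c)))"
  define U where "U = {z. max b (c - 1/2) < Re z \<and> Re z < c + 3/2}"
  have U: "U = {z. max b (c - 1/2) < Re z} \<inter> {z. Re z < c + 3/2}" by (auto simp: U_def)
  have openU: "open U" unfolding U by (intro open_Int open_halfspace_Re_gt open_halfspace_Re_lt)
  have convU: "convex U" unfolding U by (intro convex_Int convex_halfspace_Re_gt convex_halfspace_Re_lt)
  have GU: "G holomorphic_on U" by (rule holomorphic_on_subset[OF G]) (auto simp: U_def)
  have dGU: "deriv G holomorphic_on U" by (rule holomorphic_deriv[OF GU openU])
  have z0U: "z0 \<in> U" using \<open>b < c\<close> by (simp add: z0_def U_def)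
  have z0_arg: "of_real pi * (z0 - of_real c) = of_real (pi / 2)" by (simp add: z0_def)
  have C0: "C z0 = 0" and S0: "S z0 = 1"
    unfolding C_def S_def z0_arg cos_of_real sin_of_real by simp_all
  have C_nz: "C z \<noteq> 0" if "z \<in> U - {z0}" for z
    using cos_zero_in_strip[of z c] that by (auto simp: C_def U_def z0_def)
  have dC: "(C has_field_derivative - of_real pi * S z) (at z)" for z
    unfolding C_def S_def by (auto intro!: derivative_eq_intros)
  have dS: "(S has_field_derivative of_real pi * C z) (at z)" for z
    unfolding C_def S_def by (auto intro!: derivative_eq_intros)
  have holC: "C holomorphic_on A" and holS: "S holomorphic_on A" for A
    unfolding C_def S_def by (auto intro!: holomorphic_intros)
  have path: "path_image ?\<gamma> \<subseteq> U - {z0}"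
  proof -
    have "path_image ?\<gamma> = cbox (Complex c (-T)) (Complex (c+1) T) - box (Complex c (-T)) (Complex (c+1) T)"
      using \<open>T > 0\<close> by (intro path_image_rectpath_cbox_minus_box) auto
    then show ?thesis using \<open>b < c\<close> \<open>T > 0\<close>
      by (auto simp: in_cbox_complex_iff in_box_complex_iff U_def z0_def)
  qed
  have P: "((\<lambda>w. G w * (S w / C w) / of_real pi) has_field_derivative
              G z / C z ^ 2 + deriv G z * S z / C z / of_real pi) (at z within (U - {z0}))"
    if z: "z \<in> U - {z0}" for z
  proof -
    have dG: "(G has_field_derivative deriv G z) (at z)"
      using GU openU z by (auto intro: holomorphic_derivI)
    have sc: "C z * C z + S z * S z = 1"
      using sin_cos_squared_add[of "of_real pi * (z - of_real c)"]
      by (simp add: C_def S_def power2_eq_square add.commute)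
    have "((\<lambda>w. G w * (S w / C w) / of_real pi) has_field_derivative
             (deriv G z * (S z / C z) + G z * of_real pi * (C z * C z + S z * S z) / (C z * C z)) / of_real pi) (at z)"
      using C_nz[OF z] by (auto intro!: derivative_eq_intros dG dS dC simp: field_simps)
    also have "(deriv G z * (S z / C z) + G z * of_real pi * (C z * C z + S z * S z) / (C z * C z)) / of_real pi =
                 G z / C z ^ 2 + deriv G z * S z / C z / of_real pi"
      unfolding sc by (simp add: field_simps power2_eq_square)
    finally show ?thesis by (rule has_field_derivative_at_within)
  qed
  have zero: "((\<lambda>z. G z / C z ^ 2 + deriv G z * S z / C z / of_real pi) has_contour_integral 0) ?\<gamma>"
    using contour_integral_primitive[OF P _ path] by simp
  have hol: "(\<lambda>z. deriv G z * S z / C z / of_real pi) holomorphic_on U - {z0}"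
    by (intro holomorphic_intros holomorphic_on_subset[OF dGU] holC holS) (use C_nz in auto)
  have res: "contour_integral ?\<gamma> (\<lambda>z. deriv G z * S z / C z / of_real pi) =
               - (2 * \<i> * deriv G z0 / of_real pi)"
  proof -
    have lim: "((\<lambda>w. deriv G w * S w / C w / of_real pi * (w - z0)) \<longlongrightarrow>
                 deriv G z0 * S z0 / of_real pi * (1 / (- of_real pi * S z0))) (at z0)"
    proof -
      have "((\<lambda>w. (C w - C z0) / (w - z0)) \<longlongrightarrow> - of_real pi * S z0) (at z0)"
        using dC[of z0] by (simp add: has_field_derivative_iff)
      then have "((\<lambda>w. 1 / ((C w - C z0) / (w - z0))) \<longlongrightarrow> 1 / (- of_real pi * S z0)) (at z0)"
        by (intro tendsto_divide tendsto_const) (simp_all add: S0)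
      note inv = this
      have "((\<lambda>w. deriv G w * S w / of_real pi) \<longlongrightarrow> deriv G z0 * S z0 / of_real pi) (at z0)"
      proof -
        have "(\<lambda>w. deriv G w * S w / of_real pi) holomorphic_on U"
          by (intro holomorphic_intros dGU holS) auto
        then show ?thesis
          using openU z0U
          by (meson continuous_on_eq_continuous_at holomorphic_on_imp_continuous_on isCont_def)
      qed
      from tendsto_mult[OF this inv] show ?thesis
        by (simp add: C0 mult_ac)
    qed
    have r: "residue (\<lambda>z. deriv G z * S z / C z / of_real pi) z0 =
               deriv G z0 * S z0 / of_real pi * (1 / (- of_real pi * S z0))"
      by (rule residue_simple'[OF openU z0U hol lim])
    have w: "winding_number ?\<gamma> z0 = 1"
      by (rule winding_number_rectpath) (use \<open>T > 0\<close> in \<open>auto simp: in_box_complex_iff z0_def\<close>)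
    have "contour_integral ?\<gamma> (\<lambda>z. deriv G z * S z / C z / of_real pi) =
            2 * pi * \<i> * (\<Sum>p\<in>{z0}. winding_number ?\<gamma> p *
               residue (\<lambda>z. deriv G z * S z / C z / of_real pi) p)"
    proof (rule Residue_theorem[OF openU _ _ hol _ _ path])
      show "\<forall>z. z \<notin> U \<longrightarrow> winding_number ?\<gamma> z = 0"
        using path convU by (auto intro!: winding_number_zero_outside[of _ U])
    qed (use convU in \<open>auto intro: convex_connected\<close>)
    also have "\<dots> = - (2 * \<i> * deriv G z0 / of_real pi)"
      using r by (simp add: w S0)
    finally show ?thesis .
  qed
  have int: "(\<lambda>z. deriv G z * S z / C z / of_real pi) contour_integrable_on ?\<gamma>"
    by (rule contour_integrable_holomorphic_simple[where S = "U - {z0}"])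
       (use openU path hol in auto)
  have "(?f has_contour_integral 0 - - (2 * \<i> * deriv G z0 / of_real pi)) ?\<gamma>"
    using has_contour_integral_diff[OF zero has_contour_integral_integral[OF int], unfolded res]
    by (simp add: C_def)
  then show ?thesis
    using contour_integral_unique z0_def by fastforce
qed

text \<open>
  The kernel average of \<open>G\<close> over a vertical line, as a function of the line, has a unit difference
  that is a derivative of \<open>G\<close> at the midpoint: the two averages are the vertical sides of the
  rectangle in \<open>contour_integral_rectangle_sec_squared\<close>, and on the horizontal
  sides at height \<open>\<plusminus>T\<close> the secant squared is at most \<open>1 / sinh\<^sup>2(\<pi> T)\<close>, which beats the growth of
  \<open>G\<close>.
\<close>
lemma vertical_mean_difference:
  fixes G :: "complex \<Rightarrow> complex" and b c B :: real
  assumes G: "G holomorphic_on {z. b < Re z}" and "b < c"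
    and bound: "\<And>z. c \<le> Re z \<Longrightarrow> Re z \<le> c + 1 \<Longrightarrow> norm (G z) \<le> B * exp \<bar>Im z\<bar>"
  shows "(LINT x|lborel. sech_kernel x *\<^sub>R G (Complex c x)) -
         (LINT x|lborel. sech_kernel x *\<^sub>R G (Complex (c + 1) x)) = - deriv G (of_real (c + 1/2))"
proof -
  define I where "I = (\<lambda>u T. integral {-T..T} (\<lambda>x. sech_kernel x *\<^sub>R G (Complex u x)))"
  define f where "f = (\<lambda>z. G z / cos (of_real pi * (z - of_real c)) ^ 2)"
  have B: "B \<ge> 0" using order_trans[OF norm_ge_zero bound[of "of_real c"]] by simp
  have contG: "continuous_on {z. b < Re z} G"
    using G by (rule holomorphic_on_imp_continuous_on)
  have cont: "continuous_on UNIV (\<lambda>x. G (Complex u x))" if "u \<ge> c" for u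
    by (rule continuous_on_compose2[OF contG])
       (use that \<open>b < c\<close> in \<open>auto simp: Complex_eq intro!: continuous_intros\<close>)
  have lim: "(\<lambda>n. I u (real n)) \<longlonglongrightarrow> (LINT x|lborel. sech_kernel x *\<^sub>R G (Complex u x))"
    if "u = c \<or> u = c + 1" for u
    unfolding I_def
    by (intro tendsto_integral_symmetric_interval integrable_sech_kernel[where B = B] cont)
       (use that bound[of "Complex u _"] in auto)
  have error: "norm (I (c + 1) T - I c T - deriv G (of_real (c + 1/2))) \<le> pi * B * exp T / sinh (pi * T) ^ 2"
    if T: "T > 0" for T
  proof -
    define a1 a2 a3 a4 where "a1 = Complex c (-T)" and "a2 = Complex (c+1) (-T)"
      and "a3 = Complex (c+1) T" and "a4 = Complex c T"
    have cont_side: "f contour_integrable_on linepath p q"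
      if "closed_segment p q \<subseteq> path_image (rectpath a1 a3)" for p q
    proof (rule contour_integrable_continuous_linepath, unfold f_def,
           intro continuous_intros continuous_on_subset[OF contG] ballI)
      have "path_image (rectpath a1 a3) = cbox a1 a3 - box a1 a3"
        using T by (intro path_image_rectpath_cbox_minus_box) (auto simp: a1_def a3_def)
      then have on: "z \<in> cbox a1 a3 - box a1 a3" if "z \<in> closed_segment p q" for z
        using \<open>closed_segment p q \<subseteq> _\<close> that by auto
      show "closed_segment p q \<subseteq> {z. b < Re z}"
        using on \<open>b < c\<close> by (fastforce simp: a1_def a3_def in_cbox_complex_iff)
      fix z assume "z \<in> closed_segment p q"
      from on[OF this] show "cos (of_real pi * (z - of_real c)) ^ 2 \<noteq> 0"
        using cos_zero_in_strip[of z c] T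
        by (auto simp: a1_def a3_def in_cbox_complex_iff in_box_complex_iff)
    qed
    have pr: "path_image (rectpath a1 a3) =
        closed_segment a1 a2 \<union> closed_segment a2 a3 \<union> closed_segment a3 a4 \<union> closed_segment a4 a1"
      by (simp add: rectpath_def Let_def path_image_join Un_assoc a1_def a2_def a3_def a4_def)
    have sides: "f contour_integrable_on linepath a1 a2" "f contour_integrable_on linepath a2 a3"
                "f contour_integrable_on linepath a3 a4" "f contour_integrable_on linepath a4 a1"
      by (rule cont_side, use pr in blast)+
    have rect: "rectpath a1 a3 = linepath a1 a2 +++ linepath a2 a3 +++ linepath a3 a4 +++ linepath a4 a1"
      by (simp add: rectpath_def Let_def a1_def a2_def a3_def a4_def)
    have "contour_integral (rectpath a1 a3) f =
        contour_integral (linepath a1 a2) f + (contour_integral (linepath a2 a3) f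
         + (contour_integral (linepath a3 a4) f + contour_integral (linepath a4 a1) f))"
      unfolding rect using sides by simp
    also have "contour_integral (linepath a4 a1) f = - contour_integral (linepath a1 a4) f"
      using contour_integral_reversepath[of "linepath a1 a4" f] by simp
    finally have split: "2 * \<i> * deriv G (of_real (c + 1/2)) / of_real pi =
        contour_integral (linepath a1 a2) f + (contour_integral (linepath a2 a3) f
         + (contour_integral (linepath a3 a4) f - contour_integral (linepath a1 a4) f))"
      using contour_integral_rectangle_sec_squared[OF G \<open>b < c\<close> T] by (simp add: f_def a1_def a3_def)
    have side: "\<i> * integral {-T..T} (\<lambda>x. f (Complex u x)) = \<i> * (2 / of_real pi) * I u T"
      if "u = c \<or> u = c + 1" for u
    proof -
      have "cos (of_real pi * (Complex u x - of_real c)) ^ 2 = of_real (cosh (pi * x)) ^ 2" for x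
      proof (cases "u = c")
        case False
        with that have u: "u = c + 1" by simp
        have "of_real pi * (Complex u x - of_real c) = of_real pi * (Complex c x - of_real c) + of_real pi"
          by (simp add: u complex_eq_iff algebra_simps)
        then show ?thesis using cos_vertical[of c x] by (simp add: cos_add)
      qed (simp add: cos_vertical)
      then have "f (Complex u x) = (2 / of_real pi) * (sech_kernel x *\<^sub>R G (Complex u x))" for x
        by (simp add: f_def sech_kernel_def scaleR_conv_of_real)
      then show ?thesis by (simp only: I_def mult.assoc integral_mult_right)
    qed
    have right: "contour_integral (linepath a2 a3) f = \<i> * (2 / of_real pi) * I (c + 1) T"
      using T by (subst contour_integral_linepath_same_Re[where c = "c+1" and a = "-T" and b = T])
                 (auto simp: a2_def a3_def side)
    have left: "contour_integral (linepath a1 a4) f = \<i> * (2 / of_real pi) * I c T"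
      using T by (subst contour_integral_linepath_same_Re[where c = c and a = "-T" and b = T])
                 (auto simp: a1_def a4_def side)
    have f_le: "norm (f z) \<le> B * exp T / sinh (pi * T) ^ 2"
      if "c \<le> Re z" "Re z \<le> c + 1" "\<bar>Im z\<bar> = T" for z
    proof -
      have "\<bar>sinh (pi * Im z)\<bar> \<le> norm (cos (of_real pi * (z - of_real c)))"
        using norm_cos_ge[of "of_real pi * (z - of_real c)"] by simp
      moreover have "\<bar>sinh (pi * Im z)\<bar> = sinh (pi * T)"
        using that by (metis abs_mult abs_of_nonneg pi_ge_zero sinh_real_abs)
      ultimately have "sinh (pi * T) ^ 2 \<le> norm (cos (of_real pi * (z - of_real c))) ^ 2"
        using T by (intro power_mono) auto
      moreover have "sinh (pi * T) ^ 2 > 0" using T by simp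
      ultimately show ?thesis
        using bound[of z] that B unfolding f_def norm_divide norm_power
        by (intro frac_le) auto
    qed
    have seg: "c \<le> Re z \<and> Re z \<le> c + 1 \<and> Im z = y"
      if "z \<in> closed_segment (Complex c y) (Complex (c+1) y)" for y z
      using that by (subst (asm) closed_segment_same_Im) (auto simp: closed_segment_eq_real_ivl)
    have bottom: "norm (contour_integral (linepath a1 a2) f) \<le> B * exp T / sinh (pi * T) ^ 2"
    proof -
      have "norm (contour_integral (linepath a1 a2) f) \<le> B * exp T / sinh (pi * T) ^ 2 * norm (a2 - a1)"
      proof (rule contour_integral_bound_linepath)
        fix z assume "z \<in> closed_segment a1 a2"
        then show "norm (f z) \<le> B * exp T / sinh (pi * T) ^ 2"
          using seg[of z "-T"] T by (intro f_le) (auto simp: a1_def a2_def)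
      qed (use sides B in auto)
      also have "norm (a2 - a1) = 1" by (simp add: a1_def a2_def cmod_def)
      finally show ?thesis by simp
    qed
    have top: "norm (contour_integral (linepath a3 a4) f) \<le> B * exp T / sinh (pi * T) ^ 2"
    proof -
      have "norm (contour_integral (linepath a3 a4) f) \<le> B * exp T / sinh (pi * T) ^ 2 * norm (a4 - a3)"
      proof (rule contour_integral_bound_linepath)
        fix z assume "z \<in> closed_segment a3 a4"
        then show "norm (f z) \<le> B * exp T / sinh (pi * T) ^ 2"
          using seg[of z T] T by (intro f_le) (auto simp: a3_def a4_def closed_segment_commute)
      qed (use sides B in auto)
      also have "norm (a4 - a3) = 1" by (simp add: a3_def a4_def cmod_def)
      finally show ?thesis by simp
    qed
    have "contour_integral (linepath a1 a2) f + contour_integral (linepath a3 a4) f =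
        - (2 * \<i> / of_real pi) * (I (c + 1) T - I c T - deriv G (of_real (c + 1/2)))"
      using split unfolding right left by (simp add: algebra_simps diff_divide_distrib add_divide_distrib)
    then have "I (c + 1) T - I c T - deriv G (of_real (c + 1/2)) =
        \<i> * of_real pi / 2 * (contour_integral (linepath a1 a2) f + contour_integral (linepath a3 a4) f)"
      by simp
    also have "norm \<dots> = pi / 2 * norm (contour_integral (linepath a1 a2) f + contour_integral (linepath a3 a4) f)"
      by (simp add: norm_mult norm_divide)
    also have "\<dots> \<le> pi / 2 * (B * exp T / sinh (pi * T) ^ 2 + B * exp T / sinh (pi * T) ^ 2)"
      using bottom top by (intro mult_left_mono order_trans[OF norm_triangle_ineq add_mono]) auto
    also have "\<dots> = pi * B * exp T / sinh (pi * T) ^ 2"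
      by (simp add: field_simps)
    finally show ?thesis .
  qed
  have "((\<lambda>T. exp T / sinh (pi * T) ^ 2) \<longlongrightarrow> 0) at_top"
    unfolding sinh_field_def using pi_gt3 by real_asymp
  then have "(\<lambda>n. pi * B * (exp (real n) / sinh (pi * real n) ^ 2)) \<longlonglongrightarrow> pi * B * 0"
    by (intro tendsto_mult tendsto_const filterlim_compose[OF _ filterlim_real_sequentially])
  then have "(\<lambda>n. pi * B * exp (real n) / sinh (pi * real n) ^ 2) \<longlonglongrightarrow> 0"
    by simp
  then have "(\<lambda>n. I (c + 1) (real n) - I c (real n) - deriv G (of_real (c + 1/2))) \<longlonglongrightarrow> 0"
  proof (rule Lim_null_comparison[rotated])
    show "\<forall>\<^sub>F n in sequentially. norm (I (c + 1) (real n) - I c (real n) - deriv G (of_real (c + 1/2)))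
            \<le> pi * B * exp (real n) / sinh (pi * real n) ^ 2"
      using eventually_gt_at_top[of 0] by eventually_elim (use error in simp)
  qed
  moreover have "(\<lambda>n. I (c + 1) (real n) - I c (real n) - deriv G (of_real (c + 1/2))) \<longlonglongrightarrow>
      (LINT x|lborel. sech_kernel x *\<^sub>R G (Complex (c + 1) x)) -
      (LINT x|lborel. sech_kernel x *\<^sub>R G (Complex c x)) - deriv G (of_real (c + 1/2))"
    by (intro tendsto_intros lim) auto
  ultimately show ?thesis
    using LIMSEQ_unique by (fastforce simp: algebra_simps)
qed

section \<open>Kernel averages of complex powers\<close>

lemma ln_one_plus_le:
  fixes x M :: real
  assumes "M > 0" "x \<ge> 0"
  shows "M * ln (1 + x) \<le> x + 1 + M * ln M - M"
proof -
  have "ln ((1 + x) / M) \<le> (1 + x) / M - 1"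
    using assms by (intro ln_le_minus_one) auto
  then have "M * (ln (1 + x) - ln M) \<le> M * ((1 + x) / M - 1)"
    using assms by (intro mult_left_mono) (auto simp: ln_div)
  also have "M * ((1 + x) / M - 1) = 1 + x - M"
    using assms by (simp add: field_simps)
  finally show ?thesis by (simp add: algebra_simps)
qed

text \<open>
  One constant serves all exponents in a disc, since \<open>\<bar>z\<^sup>w\<bar> \<le> exp(\<bar>w\<bar> (\<bar>ln \<bar>z\<bar>\<bar> + \<pi>))\<close> and the logarithm of
  \<open>1 + \<bar>Im z\<bar>\<close>, times any constant, is at most \<open>\<bar>Im z\<bar>\<close> plus a constant.
\<close>
lemma norm_powr_vertical_bound:
  fixes c c' M :: real
  assumes "0 < c" "0 < M"
  obtains B where "\<And>w z. norm w \<le> M \<Longrightarrow> c \<le> Re z \<Longrightarrow> Re z \<le> c' \<Longrightarrow> norm (z powr w) \<le> B * exp \<bar>Im z\<bar>"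
proof
  \<comment> \<open>Since \<open>c \<le> \<bar>z\<bar> \<le> (1 + c') (1 + \<bar>Im z\<bar>)\<close>, the logarithm of \<open>\<bar>z\<bar>\<close> is bounded by \<open>L + ln (1 + \<bar>Im z\<bar>)\<close>.\<close>
  define L where "L = \<bar>ln c\<bar> + \<bar>ln (1 + c')\<bar>"
  define B where "B = exp (M * pi + M * L + 1 + M * ln M - M)"
  fix w z :: complex
  assume w: "norm w \<le> M" and z: "c \<le> Re z" "Re z \<le> c'"
  have nz: "z \<noteq> 0" and nz': "norm z > 0" using z assms by auto
  have lower: "c \<le> norm z" using z complex_Re_le_cmod order_trans by blast
  have upper: "norm z \<le> (1 + c') * (1 + \<bar>Im z\<bar>)"
  proof -
    have "norm z \<le> \<bar>Re z\<bar> + \<bar>Im z\<bar>" by (rule cmod_le)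
    also have "\<dots> \<le> (1 + c') * (1 + \<bar>Im z\<bar>)"
    proof -
      have "0 \<le> c' * \<bar>Im z\<bar>" using z assms by (intro mult_nonneg_nonneg) auto
      moreover have "(1 + c') * (1 + \<bar>Im z\<bar>) = 1 + c' + \<bar>Im z\<bar> + c' * \<bar>Im z\<bar>"
        by (simp add: algebra_simps)
      ultimately show ?thesis using z assms by linarith
    qed
    finally show ?thesis .
  qed
  have "ln c \<le> ln (norm z)" using lower assms by (simp add: ln_mono)
  moreover have "ln (norm z) \<le> ln (1 + c') + ln (1 + \<bar>Im z\<bar>)"
  proof -
    have "ln (norm z) \<le> ln ((1 + c') * (1 + \<bar>Im z\<bar>))" using nz' upper by (intro ln_mono) auto
    also have "\<dots> = ln (1 + c') + ln (1 + \<bar>Im z\<bar>)" using z assms by (subst ln_mult) auto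
    finally show ?thesis .
  qed
  ultimately have lnz: "\<bar>ln (norm z)\<bar> \<le> L + ln (1 + \<bar>Im z\<bar>)"
    unfolding L_def using ln_ge_zero[of "1 + \<bar>Im z\<bar>"] by linarith
  have "norm (z powr w) = exp (Re (w * Ln z))" using nz by (simp add: powr_def)
  also have "\<dots> \<le> exp (M * pi + M * L + M * ln (1 + \<bar>Im z\<bar>))"
  proof -
    have "Re (w * Ln z) \<le> norm (w * Ln z)" by (rule complex_Re_le_cmod)
    also have "\<dots> \<le> M * (\<bar>Re (Ln z)\<bar> + \<bar>Im (Ln z)\<bar>)"
      unfolding norm_mult using w assms by (intro mult_mono cmod_le) auto
    also have "\<dots> \<le> M * ((L + ln (1 + \<bar>Im z\<bar>)) + pi)"
      using lnz mpi_less_Im_Ln[OF nz] Im_Ln_le_pi[OF nz] nz assms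
      by (intro mult_left_mono add_mono) auto
    finally show ?thesis by (simp add: algebra_simps)
  qed
  also have "\<dots> \<le> exp (M * pi + M * L + 1 + M * ln M - M + \<bar>Im z\<bar>)"
    using ln_one_plus_le[OF assms(2), of "\<bar>Im z\<bar>"] by simp
  also have "\<dots> = B * exp \<bar>Im z\<bar>" by (simp add: B_def exp_add)
  finally show "norm (z powr w) \<le> B * exp \<bar>Im z\<bar>" .
qed

definition sech_mean_powr :: "real \<Rightarrow> complex \<Rightarrow> complex" where
  "sech_mean_powr c w = (LINT x|lborel. sech_kernel x *\<^sub>R (Complex c x powr w))"

lemma continuous_on_vertical_powr:
  assumes "c > 0"
  shows "continuous_on A (\<lambda>x. Complex c x powr w)"
proof -
  have "c + \<i> * x \<noteq> 0" for x :: real using assms by (simp add: complex_eq_iff)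
  then show ?thesis
    using assms by (auto simp: Complex_eq complex_nonpos_Reals_iff intro!: continuous_intros)
qed

lemma integrable_sech_mean_powr:
  assumes "c > 0"
  shows "integrable lborel (\<lambda>x. sech_kernel x *\<^sub>R (Complex c x powr w))"
proof -
  obtain B where B: "\<And>v z. norm v \<le> norm w + 1 \<Longrightarrow> c \<le> Re z \<Longrightarrow> Re z \<le> c \<Longrightarrow> norm (z powr v) \<le> B * exp \<bar>Im z\<bar>"
    using norm_powr_vertical_bound[OF assms, of "norm w + 1" c] by (auto simp: add_nonneg_pos)
  show ?thesis
    by (rule integrable_sech_kernel[where B = B])
       (use B[of w "Complex c _"] in \<open>auto intro: continuous_on_vertical_powr[OF assms]\<close>)
qed

lemma holomorphic_sech_mean_powr:
  assumes c: "c > 0"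
  shows "sech_mean_powr c holomorphic_on UNIV"
proof (rule holomorphic_uniform_sequence)
  define f where "f = (\<lambda>w x. sech_kernel x *\<^sub>R (Complex c x powr w))"
  show "(\<lambda>w. integral (cbox (-real n) (real n)) (f w)) holomorphic_on UNIV" for n
  proof (rule leibniz_rule_holomorphic)
    show "((\<lambda>w. f w x) has_field_derivative f w x * Ln (Complex c x)) (at w within UNIV)" for w x
      unfolding f_def scaleR_conv_of_real
    proof -
      have nz: "Complex c x \<noteq> 0" using c by (simp add: complex_eq_iff)
      show "((\<lambda>w. of_real (sech_kernel x) * Complex c x powr w) has_field_derivative
               of_real (sech_kernel x) * Complex c x powr w * Ln (Complex c x)) (at w within UNIV)"
        using nz unfolding powr_def by (auto intro!: derivative_eq_intros)
    qed
    show "f w integrable_on cbox (- real n) (real n)" for w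
      unfolding f_def by (intro integrable_continuous continuous_intros continuous_on_vertical_powr c)
    have nz: "c + \<i> * x \<noteq> 0" for x :: real using c by (simp add: complex_eq_iff)
    have "continuous_on (UNIV \<times> A) (\<lambda>p. f (fst p) (snd p) * Ln (Complex c (snd p)))" for A
      unfolding f_def using c nz
      by (auto simp: Complex_eq complex_nonpos_Reals_iff intro!: continuous_intros)
    then show "continuous_on (UNIV \<times> cbox (- real n) (real n)) (\<lambda>(w, x). f w x * Ln (Complex c x))"
      by (simp add: case_prod_unfold)
  qed auto
  fix w0 :: complex
  have "uniform_limit (cball w0 1) (\<lambda>n w. integral (cbox (-real n) (real n)) (f w)) (sech_mean_powr c) sequentially"
  proof -
    define M where "M = norm w0 + 1"
    have "M > 0" by (simp add: M_def add_nonneg_pos)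
    obtain B where B: "\<And>w z. norm w \<le> M \<Longrightarrow> c \<le> Re z \<Longrightarrow> Re z \<le> c \<Longrightarrow> norm (z powr w) \<le> B * exp \<bar>Im z\<bar>"
      using norm_powr_vertical_bound[OF c \<open>M > 0\<close>, of c] by blast
    define g where "g = (\<lambda>x::real. 2 * pi * B * exp (-\<bar>x\<bar>))"
    have g: "integrable lborel g" unfolding g_def using integrable_exp_minus_abs by simp
    have error: "dist (integral (cbox (-real n) (real n)) (f w)) (sech_mean_powr c w)
                   \<le> (LINT x|lborel. g x) - integral {-real n..real n} g" if "w \<in> cball w0 1" for n w
    proof -
      have "norm w \<le> M" using that norm_triangle_ineq2[of w w0] by (simp add: M_def dist_norm norm_minus_commute)
      then have "norm (f w x) \<le> g x" for x
        unfolding f_def g_def using B[of w "Complex c x"] by (intro sech_kernel_dominated) auto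
      then have "norm ((LINT x|lborel. f w x) - integral {-real n..real n} (f w))
                   \<le> (LINT x|lborel. g x) - integral {-real n..real n} g"
        by (intro integral_symmetric_interval_error g) (auto simp: f_def intro: integrable_sech_mean_powr c)
      then show ?thesis by (simp add: dist_norm norm_minus_commute sech_mean_powr_def f_def)
    qed
    have "(\<lambda>n. (LINT x|lborel. g x) - integral {-real n..real n} g) \<longlonglongrightarrow> (LINT x|lborel. g x) - (LINT x|lborel. g x)"
      by (intro tendsto_intros tendsto_integral_symmetric_interval g)
    then have lim: "(\<lambda>n. (LINT x|lborel. g x) - integral {-real n..real n} g) \<longlonglongrightarrow> 0" by simp
    show ?thesis
    proof (rule uniform_limitI)
      fix e :: real assume "e > 0"
      then have "\<forall>\<^sub>F n in sequentially. (LINT x|lborel. g x) - integral {-real n..real n} g < e"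
        using lim by (intro order_tendstoD(2)) auto
      then show "\<forall>\<^sub>F n in sequentially. \<forall>w\<in>cball w0 1.
          dist (integral (cbox (-real n) (real n)) (f w)) (sech_mean_powr c w) < e"
        by eventually_elim (use error in \<open>fastforce intro: le_less_trans\<close>)
    qed
  qed
  then show "\<exists>d>0. cball w0 d \<subseteq> UNIV \<and>
     uniform_limit (cball w0 d) (\<lambda>n w. integral (cbox (-real n) (real n)) (f w)) (sech_mean_powr c) sequentially"
    by (intro exI[of _ 1]) auto
qed auto

text \<open>
  Dividing by \<open>s - 1\<close> with \<open>w = 1 - s\<close> turns this into the difference equation of the Hurwitz zeta
  function at \<open>a = c + 1/2\<close>; it holds for every exponent, not just where the series converges.
\<close>
lemma sech_mean_powr_difference:
  assumes c: "c > 0"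
  shows "sech_mean_powr c w - sech_mean_powr (c + 1) w = - w * of_real (c + 1/2) powr (w - 1)"
proof -
  have nonpos: "z \<notin> \<real>\<^sub>\<le>\<^sub>0" if "Re z > 0" for z using that by (auto simp: complex_nonpos_Reals_iff)
  obtain B where B: "\<And>v z. norm v \<le> norm w + 1 \<Longrightarrow> c \<le> Re z \<Longrightarrow> Re z \<le> c + 1 \<Longrightarrow> norm (z powr v) \<le> B * exp \<bar>Im z\<bar>"
    using norm_powr_vertical_bound[OF c, of "norm w + 1" "c + 1"] by (auto simp: add_nonneg_pos)
  have "(\<lambda>z. z powr w) holomorphic_on {z. 0 < Re z}"
    using nonpos by (intro holomorphic_intros) auto
  then have "sech_mean_powr c w - sech_mean_powr (c + 1) w = - deriv (\<lambda>z. z powr w) (of_real (c + 1/2))"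
    unfolding sech_mean_powr_def using c B[of w]
    by (intro vertical_mean_difference[where b = 0 and B = B]) auto
  also have "deriv (\<lambda>z. z powr w) (of_real (c + 1/2)) = w * of_real (c + 1/2) powr (w - 1)"
    using c nonpos by (intro DERIV_imp_deriv has_field_derivative_powr) auto
  finally show ?thesis by simp
qed

lemma sech_mean_powr_sum:
  assumes c: "c > 0"
  shows "sech_mean_powr c w - sech_mean_powr (c + real n) w = - w * (\<Sum>r<n. of_real (c + 1/2 + real r) powr (w - 1))"
proof (induction n)
  case (Suc n)
  have "sech_mean_powr c w - sech_mean_powr (c + real (Suc n)) w =
          (sech_mean_powr c w - sech_mean_powr (c + real n) w) +
          (sech_mean_powr (c + real n) w - sech_mean_powr (c + real n + 1) w)"
    by (simp add: add_ac)
  also have "\<dots> = - w * (\<Sum>r<Suc n. of_real (c + 1/2 + real r) powr (w - 1))"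
    unfolding Suc.IH using c sech_mean_powr_difference[of "c + real n" w]
    by (simp add: algebra_simps)
  finally show ?case .
qed simp

text \<open>
  On the line \<open>Re z = u\<close> one has \<open>\<bar>z\<bar> \<ge> u\<close>, so for \<open>Re w < 0\<close> every power on that line is at most a constant
  times \<open>u\<^bsup>Re w\<^esup>\<close>.
\<close>
lemma sech_mean_powr_tendsto_0:
  assumes c: "c > 0" and w: "Re w < 0"
  shows "(\<lambda>n. sech_mean_powr (c + real n) w) \<longlonglongrightarrow> 0"
proof -
  define I where "I = (LINT x|lborel. sech_kernel x)"
  have int: "integrable lborel sech_kernel"
    using integrable_sech_kernel[of "\<lambda>_. 1" 1]
    by (simp add: scaleR_conv_of_real complex_of_real_integrable_eq)
  have bound: "norm (sech_mean_powr u w) \<le> I * exp (\<bar>Im w\<bar> * pi) * u powr Re w" if u: "u > 0" for u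
  proof -
    have pt: "norm (sech_kernel x *\<^sub>R (Complex u x powr w)) \<le> sech_kernel x * (exp (\<bar>Im w\<bar> * pi) * u powr Re w)" for x
    proof -
      have nz: "Complex u x \<noteq> 0" using u by (simp add: complex_eq_iff)
      have "u \<le> norm (Complex u x)" using complex_Re_le_cmod[of "Complex u x"] by simp
      then have "norm (Complex u x) powr Re w \<le> u powr Re w"
        using u w by (intro powr_mono2') auto
      moreover have "- Im w * Arg (Complex u x) \<le> \<bar>Im w\<bar> * pi"
        using Arg_bounded[of "Complex u x"]
        by (metis abs_ge_self abs_le_iff abs_minus_cancel abs_mult minus_mult_left mult_left_mono abs_ge_zero order_trans less_imp_le minus_le_iff)
      ultimately have "norm (Complex u x powr w) \<le> u powr Re w * exp (\<bar>Im w\<bar> * pi)"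
        unfolding norm_powr_complex by (intro mult_mono) auto
      then show ?thesis
        by (simp add: sech_kernel_nonneg mult_left_mono mult.commute)
    qed
    have "norm (sech_mean_powr u w) \<le> (LINT x|lborel. sech_kernel x * (exp (\<bar>Im w\<bar> * pi) * u powr Re w))"
      unfolding sech_mean_powr_def
      by (rule Bochner_Integration.integral_norm_bound_integral) (use pt int integrable_sech_mean_powr[OF u] in auto)
    also have "\<dots> = I * exp (\<bar>Im w\<bar> * pi) * u powr Re w"
      by (simp add: I_def)
    finally show ?thesis .
  qed
  have "((\<lambda>x. (c + x) powr Re w) \<longlongrightarrow> 0) at_top"
    using w by real_asymp
  then have "(\<lambda>n. I * exp (\<bar>Im w\<bar> * pi) * (c + real n) powr Re w) \<longlonglongrightarrow> I * exp (\<bar>Im w\<bar> * pi) * 0"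
    by (intro tendsto_mult tendsto_const filterlim_compose[OF _ filterlim_real_sequentially])
  then have "(\<lambda>n. I * exp (\<bar>Im w\<bar> * pi) * (c + real n) powr Re w) \<longlonglongrightarrow> 0" by simp
  then show ?thesis
    by (rule Lim_null_comparison[rotated]) (use bound c in \<open>auto intro!: always_eventually\<close>)
qed

text \<open>
  Reflecting the vertical line in the real axis conjugates the integrand and fixes the kernel.
\<close>
lemma cnj_sech_mean_powr:
  assumes "c > 0"
  shows "cnj (sech_mean_powr c w) = sech_mean_powr c (cnj w)"
proof -
  have "cnj (sech_mean_powr c w) = (LINT x|lborel. cnj (sech_kernel x *\<^sub>R (Complex c x powr w)))"
    unfolding sech_mean_powr_def by (rule Bochner_Integration.integral_cnj[symmetric])
  also have "\<dots> = (LINT x|lborel. sech_kernel x *\<^sub>R (Complex c (-x) powr cnj w))"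
  proof (intro Bochner_Integration.integral_cong refl)
    fix x :: real
    have "cnj (Complex c x powr w) = Complex c (-x) powr cnj w"
      using assms by (subst cnj_powr) (auto simp: complex_cnj)
    then show "cnj (sech_kernel x *\<^sub>R (Complex c x powr w)) = sech_kernel x *\<^sub>R (Complex c (-x) powr cnj w)"
      by (simp add: scaleR_conv_of_real)
  qed
  also have "\<dots> = sech_mean_powr c (cnj w)"
    unfolding sech_mean_powr_def
    by (subst lborel_integral_real_affine[of "-1" _ 0]) auto
  finally show ?thesis .
qed

section \<open>The Hurwitz zeta function as a kernel average\<close>

text \<open>
  The right-hand side is analytic away from \<open>s = 1\<close>; for \<open>Re s > 1\<close> the difference equation telescopes
  and the remainder tends to \<open>0\<close>, so it sums the defining series.
\<close>
theorem hurwitz_zeta_conv_sech_mean: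
  assumes a: "a > 1/2" and s: "s \<noteq> 1"
  shows "hurwitz_zeta s a = sech_mean_powr (a - 1/2) (1 - s) / (s - 1)"
proof -
  define c where "c = a - 1/2"
  have c: "c > 0" using a by (simp add: c_def)
  define f where "f = (\<lambda>s. sech_mean_powr c (1 - s) / (s - 1))"
  have "is_hurwitz_continuation a f"
    unfolding is_hurwitz_continuation_def
  proof (intro conjI allI impI)
    have "(\<lambda>s. sech_mean_powr c (1 - s)) holomorphic_on - {1}"
      using holomorphic_on_compose_gen[OF _ holomorphic_sech_mean_powr[OF c], of "\<lambda>s. 1 - s" "-{1}"]
      by (simp add: o_def holomorphic_intros)
    then show "f holomorphic_on - {1}"
      unfolding f_def by (intro holomorphic_intros) auto
    show "f 1 = 0" by (simp add: f_def)
    fix s :: complex assume s: "Re s > 1"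
    then have s1: "s \<noteq> 1" by auto
    have partial: "(\<Sum>r<n. of_real (a + real r) powr (-s)) = f s - sech_mean_powr (c + real n) (1 - s) / (s - 1)" for n
    proof -
      have "f s - sech_mean_powr (c + real n) (1 - s) / (s - 1) =
              (sech_mean_powr c (1 - s) - sech_mean_powr (c + real n) (1 - s)) / (s - 1)"
        by (simp add: f_def diff_divide_distrib)
      also have "\<dots> = (\<Sum>r<n. of_real (c + 1/2 + real r) powr (1 - s - 1))"
        unfolding sech_mean_powr_sum[OF c] using s1 by simp
      also have "c + 1/2 = a" by (simp add: c_def)
      finally show ?thesis by simp
    qed
    have "(\<lambda>n. f s - sech_mean_powr (c + real n) (1 - s) / (s - 1)) \<longlonglongrightarrow> f s - 0 / (s - 1)"
      using s s1 by (intro tendsto_intros sech_mean_powr_tendsto_0 c) auto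
    then show "(\<lambda>r. of_real (a + real r) powr (-s)) sums f s"
      unfolding sums_def partial by simp
  qed
  then have "hurwitz_zeta s a = f s" by (rule hurwitz_zeta_eqI)
  then show ?thesis by (simp add: f_def c_def)
qed

lemma hurwitz_zeta_shift:
  assumes a: "a > 1/2" and s: "s \<noteq> 1"
  shows "hurwitz_zeta s a = hurwitz_zeta s (a + real n) + (\<Sum>r<n. of_real (a + real r) powr (-s))"
proof -
  have "(sech_mean_powr (a - 1/2) (1 - s) - sech_mean_powr (a - 1/2 + real n) (1 - s)) / (s - 1)
          = (\<Sum>r<n. of_real (a - 1/2 + 1/2 + real r) powr (1 - s - 1))"
    using a s by (subst sech_mean_powr_sum) auto
  then show ?thesis
    using a s by (simp add: hurwitz_zeta_conv_sech_mean diff_divide_distrib algebra_simps)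
qed

lemma hurwitz_zeta_real_at_real:
  assumes "a > 1/2" "p \<noteq> -1"
  shows "hurwitz_zeta (of_real (-p)) a \<in> \<real>"
proof -
  have "of_real (-p) \<noteq> (1::complex)" using assms(2) by (auto simp: complex_eq_iff)
  then have *: "hurwitz_zeta (of_real (-p)) a = sech_mean_powr (a - 1/2) (1 - of_real (-p)) / (of_real (-p) - 1)"
    by (rule hurwitz_zeta_conv_sech_mean[OF assms(1)])
  have "cnj (sech_mean_powr (a - 1/2) (1 - of_real (-p))) = sech_mean_powr (a - 1/2) (1 - of_real (-p))"
    using assms(1) by (subst cnj_sech_mean_powr) simp_all
  then have "sech_mean_powr (a - 1/2) (1 - of_real (-p)) \<in> \<real>"
    by (simp only: Reals_cnj_iff)
  then show ?thesis unfolding * by (intro Reals_divide Reals_diff) auto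
qed

section \<open>Stirling's bound and the comparison of main terms\<close>

text \<open>
  The function \<open>\<phi>(x) = ln \<Gamma>(x + 1) - (x + 1/2) ln x + x\<close> does not increase under \<open>x \<mapsto> x + 1\<close>, so a bound
  on \<open>[1, 2]\<close> holds on \<open>[1, \<infinity>)\<close>; on \<open>[1, 2]\<close> the log-convexity of \<open>\<Gamma>\<close> provides one. The asymptotic
  constant is \<open>\<surd>(2\<pi>) \<approx> 2.507\<close>; any constant below \<open>\<pi>\<close> is good enough for the application, and
  \<open>exp(11/10) \<approx> 3.004\<close> is.
\<close>
lemma Gamma_le_Stirling:
  fixes x :: real
  assumes "x \<ge> 1"
  shows "Gamma (x + 1) \<le> exp (11/10) * (sqrt x * (x / exp 1) powr x)"
proof -
  define \<phi> where "\<phi> = (\<lambda>x::real. ln (Gamma (x + 1)) - (x + 1/2) * ln x + x)"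
  have base: "\<phi> x \<le> 11/10" if x: "1 \<le> x" "x \<le> 2" for x
  proof -
    have "(ln \<circ> Gamma) ((1 - (x - 1)) *\<^sub>R 2 + (x - 1) *\<^sub>R 3) \<le>
            (1 - (x - 1)) * (ln \<circ> Gamma) 2 + (x - 1) * (ln \<circ> Gamma) (3::real)"
      using x by (intro convex_onD[OF log_convex_Gamma_real]) auto
    moreover have "(1 - (x - 1)) *\<^sub>R 2 + (x - 1) *\<^sub>R 3 = x + 1" by simp
    moreover have "Gamma 2 = (1::real)" "Gamma 3 = (2::real)"
      using Gamma_fact[of 1, where 'a = real] Gamma_fact[of 2, where 'a = real] by simp_all
    ultimately have "ln (Gamma (x + 1)) \<le> (x - 1) * ln 2" by simp
    also have "\<dots> \<le> (x - 1) * (25/36)"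
      using x ln2_le_25_over_36 by (intro mult_left_mono) auto
    finally have 1: "ln (Gamma (x + 1)) \<le> (x - 1) * (25/36)" .
    \<comment> \<open>The midpoint rule for the integral of \<open>1/t\<close>; it is used again in the step, on \<open>[x, x + 1]\<close>.\<close>
    have "2 * (x - 1) / (x + 1) \<le> ln x"
    proof (cases "x = 1")
      case False
      with x show ?thesis using ln_inverse_approx_ge[of 1 x] by (simp add: add.commute)
    qed simp
    then have "(x + 1/2) * (2 * (x - 1) / (x + 1)) \<le> (x + 1/2) * ln x"
      using x by (intro mult_left_mono) auto
    with 1 have "\<phi> x \<le> (x - 1) * (25/36) - (x + 1/2) * (2 * (x - 1) / (x + 1)) + x"
      unfolding \<phi>_def by linarith
    also have "\<dots> \<le> 11/10"
    proof -
      have "11/10 - ((x - 1) * (25/36) - (x + 1/2) * (2 * (x - 1) / (x + 1)) + x)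
              = (11/36 * x^2 - 9/10 * x + 143/180) / (x + 1)"
        using x by (simp add: field_simps power2_eq_square)
      also have "\<dots> \<ge> 0" 
      proof -
        have "11/36 * x^2 - 9/10 * x + 143/180 = 11/36 * (x - 81/55)^2 + (143/180 - 729/1100)"
          by (simp add: power2_eq_square field_simps)
        also have "\<dots> \<ge> 0" by simp
        finally show ?thesis using x by simp
      qed
      finally show ?thesis by simp
    qed
    finally show ?thesis .
  qed
  have step: "\<phi> (x + 1) \<le> \<phi> x" if x: "x \<ge> 1" for x
  proof -
    have pos: "Gamma (x + 1) > 0" "x + 1 \<notin> \<int>\<^sub>\<le>\<^sub>0"
      using x by (auto intro: Gamma_real_pos elim!: nonpos_Ints_cases)
    have "2 / (2 * x + 1) \<le> ln (x + 1) - ln x"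
      using x ln_inverse_approx_ge[of x "x + 1"] by simp
    then have "(x + 1/2) * (2 / (2 * x + 1)) \<le> (x + 1/2) * (ln (x + 1) - ln x)"
      using x by (intro mult_left_mono) auto
    moreover have "(x + 1/2) * (2 / (2 * x + 1)) = 1" using x by (simp add: field_simps)
    moreover have "ln (Gamma (x + 1 + 1)) = ln (x + 1) + ln (Gamma (x + 1))"
      using x pos by (subst Gamma_plus1) (auto simp: ln_mult less_imp_neq[OF pos(1), symmetric])
    ultimately show ?thesis unfolding \<phi>_def by (simp add: algebra_simps)
  qed
  have "\<phi> x \<le> 11/10" if "1 + real n \<le> x" "x \<le> 2 + real n" for n x
    using that
  proof (induction n arbitrary: x)
    case (Suc n)
    have "\<phi> (x - 1) \<le> 11/10" using Suc.prems by (intro Suc.IH) auto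
    with step[of "x - 1"] Suc.prems show ?case by simp
  qed (use base in auto)
  from this[of "nat \<lfloor>x\<rfloor> - 1" x] have "\<phi> x \<le> 11/10"
    using assms by (simp add: of_nat_diff) linarith
  then have "ln (Gamma (x + 1)) \<le> 11/10 + (x + 1/2) * ln x - x"
    unfolding \<phi>_def by linarith
  moreover have "Gamma (x + 1) > 0" using assms by (intro Gamma_real_pos) auto
  ultimately have "Gamma (x + 1) \<le> exp (11/10 + (x + 1/2) * ln x - x)"
    by (metis exp_le_cancel_iff exp_ln)
  also have "\<dots> = exp (11/10) * (x powr (1/2) * (x powr x * exp (-x)))"
    using assms by (simp add: powr_def algebra_simps flip: exp_add)
  also have "\<dots> = exp (11/10) * (sqrt x * (x / exp 1) powr x)"
  proof -
    have "(x / exp 1) powr x = exp (x * (ln x - 1))"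
      using assms by (simp add: powr_def ln_div)
    also have "\<dots> = x powr x * exp (-x)"
      using assms by (simp add: powr_def right_diff_distrib flip: exp_add)
    finally show ?thesis using assms by (simp add: powr_half_sqrt)
  qed
  finally show ?thesis .
qed

text \<open>
  The exponent is \<open>11/10\<close> from the Stirling bound plus \<open>1/40\<close> from the shift \<open>1/256\<close> in
  \<open>norm_vertical_le\<close>, as \<open>2\<pi>/256 \<le> 1/40\<close>.
\<close>
lemma exp_nine_eighths_le: "exp (9/8 :: real) \<le> 99/100 * pi"
proof -
  have "exp (9/8 :: real) = exp 1 * exp (1/8)" by (simp flip: exp_add)
  also have "\<dots> \<le> 272/100 * (1 + 1/8 + (1/8)^2)"
    using e_less_272 exp_bound[of "1/8"] by (intro mult_mono) auto
  also have "\<dots> \<le> 99/100 * pi" using pi_approx by (simp add: power2_eq_square)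
  finally show ?thesis .
qed

text \<open>
  Writing the base on the right as \<open>(p / (2\<pi>e)) (1 + ln p / (2p))\<close>, the factor
  \<open>(1 + ln p / (2p))\<^sup>p\<close> is asymptotic to \<open>\<surd>p\<close>. So the logarithmic term supplies the factor \<open>\<surd>p\<close> of
  Stirling's formula, and the constant \<open>99/100 < 1\<close> decides the comparison.
\<close>
lemma last_term_eventually_dominates:
  fixes M :: real
  assumes M: "M > 0"
  shows "eventually (\<lambda>p. 99/100 * (sqrt p * (p / (2 * pi * exp 1)) powr p) + 2 * M powr (p + 1) / (p + 1)
           < (p / (2 * pi * exp 1) + 1 / (4 * pi * exp 1) * ln p) powr p) at_top"
proof -
  define b :: real where "b = 2 * pi * exp 1"
  have b: "b > 0" by (simp add: b_def)
  have "((\<lambda>p::real. (1 + ln p / (2 * p)) powr p / sqrt p) \<longlongrightarrow> 1) at_top"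
    by real_asymp
  then have 1: "eventually (\<lambda>p::real. (1 + ln p / (2 * p)) powr p / sqrt p > 995/1000) at_top"
    by (rule order_tendstoD) simp
  have "((\<lambda>p::real. 2 * M powr (p + 1) / (p + 1) / (sqrt p * (p / b) powr p)) \<longlongrightarrow> 0) at_top"
  proof (rule Lim_transform_eventually)
    show "((\<lambda>p::real. 2 * M / ((p + 1) * sqrt p) * ((M * b) / p) powr p) \<longlongrightarrow> 0) at_top"
    proof (rule tendsto_mult_zero)
      show "((\<lambda>p::real. 2 * M / ((p + 1) * sqrt p)) \<longlongrightarrow> 0) at_top" by real_asymp
      have "M * b > 0" using M b by simp
      then show "((\<lambda>p::real. ((M * b) / p) powr p) \<longlongrightarrow> 0) at_top"
        by real_asymp
    qed
    show "\<forall>\<^sub>F p in at_top. 2 * M / ((p + 1) * sqrt p) * ((M * b) / p) powr p =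
            2 * M powr (p + 1) / (p + 1) / (sqrt p * (p / b) powr p)"
      using eventually_gt_at_top[of "0::real"]
      by eventually_elim (use M b in \<open>simp add: powr_mult powr_divide powr_add mult_ac\<close>)
  qed
  then have 2: "eventually (\<lambda>p::real. 2 * M powr (p + 1) / (p + 1) / (sqrt p * (p / b) powr p) < 5/1000) at_top"
    by (rule order_tendstoD) simp
  show ?thesis
    using 1 2 eventually_gt_at_top[of "1::real"]
  proof eventually_elim
    case (elim p)
    define Q where "Q = sqrt p * (p / b) powr p"
    have Q: "Q > 0" using elim b by (simp add: Q_def)
    have "2 * M powr (p + 1) / (p + 1) < 5/1000 * Q"
      using elim(2) unfolding Q_def[symmetric] pos_divide_less_eq[OF Q] .
    moreover have "995/1000 * sqrt p < (1 + ln p / (2 * p)) powr p"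
      using elim(1,3) by (simp add: pos_less_divide_eq)
    then have "995/1000 * sqrt p * (p / b) powr p < (1 + ln p / (2 * p)) powr p * (p / b) powr p"
      using elim b by (intro mult_strict_right_mono) auto
    moreover have "(1 + ln p / (2 * p)) powr p * (p / b) powr p = ((1 + ln p / (2 * p)) * (p / b)) powr p"
      by (rule powr_mult[symmetric])
    moreover have "(1 + ln p / (2 * p)) * (p / b) = p / b + 1 / (4 * pi * exp 1) * ln p"
      using elim by (simp add: b_def field_simps)
    ultimately show ?case by (simp add: Q_def b_def)
  qed
qed

section \<open>The size of the Hurwitz zeta function at negative reals\<close>

text \<open>
  The alternative in the hypothesis separates the part of the line far from the real axis, where
  \<open>\<bar>c + i x\<bar>\<close> is nearly \<open>\<bar>x\<bar>\<close> and Euler's integral gives the main term with a factor near \<open>1\<close>, from a bounded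
  part whose contribution is merely exponential in \<open>q\<close>. Using \<open>\<bar>c + i x\<bar> \<le> \<bar>x\<bar> + c\<close> throughout would cost
  the factor \<open>exp(2\<pi>c)\<close>, which is too much.
\<close>
lemma norm_sech_mean_powr_le:
  fixes c q \<epsilon> M :: real
  assumes c: "c > 0" and q: "q \<ge> 0" and \<epsilon>: "\<epsilon> \<ge> 0" and M: "M \<ge> 0"
    and split: "\<And>x. norm (Complex c x) \<le> \<bar>x\<bar> + \<epsilon> \<or> norm (Complex c x) \<le> M"
  shows "norm (sech_mean_powr c (of_real q)) \<le>
           2 * exp (2 * pi * \<epsilon>) * Gamma (q + 1) / (2 * pi) powr q + 2 * M powr q"
proof -
  define k where "k = (\<lambda>r x. exp (-(2 * pi * \<bar>x\<bar>)) * (\<bar>x\<bar> + \<epsilon>) powr r)"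
  define k0 where "k0 = (\<lambda>x::real. exp (-(2 * pi * \<bar>x\<bar>)) * (\<bar>x\<bar> + 0) powr 0)"
  have k: "integrable lborel (k q)" "(LINT x|lborel. k q x) \<le> 2 * exp (2 * pi * \<epsilon>) * Gamma (q + 1) / (2 * pi) powr (q + 1)"
    unfolding k_def using q \<epsilon> by (intro integral_shifted_Gamma_le; simp)+
  have k0: "integrable lborel k0" "(LINT x|lborel. k0 x) \<le> 2 * exp (2 * pi * 0) * Gamma (0 + 1) / (2 * pi) powr (0 + 1)"
    unfolding k0_def by (intro integral_shifted_Gamma_le; simp)+
  \<comment> \<open>At \<open>x = 0\<close> the convention \<open>0 powr 0 = 0\<close> makes \<open>k0\<close> vanish, so this point is excluded.\<close>
  have pt: "norm (sech_kernel x *\<^sub>R (Complex c x powr of_real q)) \<le> 2 * pi * k q x + 2 * pi * M powr q * k0 x"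
    if x: "x \<noteq> 0" for x
  proof -
    have "norm (Complex c x powr of_real q) = norm (Complex c x) powr q"
      by (simp add: norm_powr_real_powr')
    also have "\<dots> \<le> (\<bar>x\<bar> + \<epsilon>) powr q + M powr q"
      using split[of x]
    proof
      assume "norm (Complex c x) \<le> \<bar>x\<bar> + \<epsilon>"
      then have "norm (Complex c x) powr q \<le> (\<bar>x\<bar> + \<epsilon>) powr q" using q by (intro powr_mono2) auto
      then show ?thesis by (simp add: add_increasing2)
    next
      assume "norm (Complex c x) \<le> M"
      then have "norm (Complex c x) powr q \<le> M powr q" using q by (intro powr_mono2) auto
      then show ?thesis by (simp add: add_increasing)
    qed
    finally have "norm (sech_kernel x *\<^sub>R (Complex c x powr of_real q))
        \<le> (2 * pi * exp (-(2 * pi * \<bar>x\<bar>))) * ((\<bar>x\<bar> + \<epsilon>) powr q + M powr q)"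
      using sech_kernel_le[of x] sech_kernel_nonneg[of x]
      by (simp only: norm_scaleR abs_of_nonneg) (intro mult_mono, auto)
    also have "\<dots> = 2 * pi * k q x + 2 * pi * M powr q * k0 x"
      using x by (simp add: k_def k0_def algebra_simps)
    finally show ?thesis .
  qed
  have "AE x in lborel. x \<noteq> (0::real)" by (rule AE_lborel_singleton)
  then have ae: "AE x in lborel. norm (sech_kernel x *\<^sub>R (Complex c x powr of_real q)) \<le> 2 * pi * k q x + 2 * pi * M powr q * k0 x"
    by eventually_elim (rule pt)
  have "norm (sech_mean_powr c (of_real q)) \<le> (LINT x|lborel. norm (sech_kernel x *\<^sub>R (Complex c x powr of_real q)))"
    unfolding sech_mean_powr_def by (rule integral_norm_bound)
  also have "\<dots> \<le> (LINT x|lborel. 2 * pi * k q x + 2 * pi * M powr q * k0 x)"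
    using k(1) k0(1) ae integrable_sech_mean_powr[OF c]
    by (intro integral_mono_AE integrable_norm) auto
  also have "\<dots> = 2 * pi * (LINT x|lborel. k q x) + 2 * pi * M powr q * (LINT x|lborel. k0 x)"
    using k(1) k0(1) by simp
  also have "\<dots> \<le> 2 * pi * (2 * exp (2 * pi * \<epsilon>) * Gamma (q + 1) / (2 * pi) powr (q + 1))
                   + 2 * pi * M powr q * (2 * exp (2 * pi * 0) * Gamma (0 + 1) / (2 * pi) powr (0 + 1))"
    using k(2) k0(2) by (intro add_mono mult_left_mono) auto
  also have "\<dots> = 2 * exp (2 * pi * \<epsilon>) * Gamma (q + 1) / (2 * pi) powr q + 2 * M powr q"
    by (simp add: powr_add)
  finally show ?thesis .
qed

text \<open>
  For \<open>\<bar>x\<bar> \<ge> 288 = (3/2)\<^sup>2 \<sqdot> 128\<close> the excess \<open>c\<^sup>2\<close> fits into the cross term \<open>2\<bar>x\<bar>/256\<close> of the square; below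
  that, \<open>c + \<bar>x\<bar> \<le> 290\<close>.
\<close>
lemma norm_vertical_le:
  fixes c x :: real
  assumes "0 < c" "c \<le> 3/2"
  shows "norm (Complex c x) \<le> \<bar>x\<bar> + 1/256 \<or> norm (Complex c x) \<le> 290"
proof (cases "\<bar>x\<bar> \<ge> 288")
  case True
  have "c\<^sup>2 \<le> (3/2)\<^sup>2" using assms by (intro power_mono) auto
  then have "c\<^sup>2 + x\<^sup>2 \<le> (\<bar>x\<bar> + 1/256)\<^sup>2"
  proof -
    have "(\<bar>x\<bar> + 1/256)\<^sup>2 = x\<^sup>2 + \<bar>x\<bar> / 128 + (1/256)\<^sup>2" by (simp add: power2_sum)
    moreover have "(3/2)\<^sup>2 = (9/4 :: real)" by (simp add: power2_eq_square)
    moreover have "(1/256 :: real)\<^sup>2 \<ge> 0" by simp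
    ultimately show ?thesis using \<open>c\<^sup>2 \<le> (3/2)\<^sup>2\<close> True by linarith
  qed
  then have "sqrt (c\<^sup>2 + x\<^sup>2) \<le> \<bar>x\<bar> + 1/256"
    by (intro real_le_lsqrt) auto
  then show ?thesis by (simp add: complex_norm)
next
  case False
  then show ?thesis using cmod_le[of "Complex c x"] assms by auto
qed

text \<open>
  The main term has the size that Hurwitz's formula gives for \<open>\<zeta>(-p, a)\<close> on the unit interval, namely
  \<open>2 \<Gamma>(p + 1) / (2\<pi>)\<^bsup>p + 1\<^esup>\<close>, rewritten by Stirling's bound with a constant still
  below \<open>1\<close>.
\<close>
lemma norm_hurwitz_zeta_le:
  fixes p a :: real
  assumes p: "p \<ge> 1" and a: "1 \<le> a" "a \<le> 2"
  shows "norm (hurwitz_zeta (of_real (-p)) a) \<le>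
           99/100 * (sqrt p * (p / (2 * pi * exp 1)) powr p) + 2 * 290 powr (p + 1) / (p + 1)"
proof -
  define c where "c = a - 1/2"
  have "hurwitz_zeta (of_real (-p)) a = sech_mean_powr c (1 - of_real (-p)) / (of_real (-p) - 1)"
    unfolding c_def using p a by (intro hurwitz_zeta_conv_sech_mean) (auto simp: complex_eq_iff)
  also have "1 - of_real (-p) = (of_real (p + 1) :: complex)" by simp
  also have "of_real (-p) - 1 = (of_real (- (p + 1)) :: complex)" by simp
  finally have "norm (hurwitz_zeta (of_real (-p)) a) = norm (sech_mean_powr c (of_real (p + 1))) / (p + 1)"
    using p by (simp only: norm_divide norm_of_real)
  also have "\<dots> \<le> (2 * exp (2 * pi * (1/256)) * Gamma (p + 1 + 1) / (2 * pi) powr (p + 1) + 2 * 290 powr (p + 1)) / (p + 1)"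
    using p a norm_vertical_le[of c]
    by (intro divide_right_mono norm_sech_mean_powr_le) (auto simp: c_def)
  also have "Gamma (p + 1 + 1) = (p + 1) * Gamma (p + 1)"
    using p by (subst Gamma_plus1) (auto elim!: nonpos_Ints_cases)
  also have "(2 * exp (2 * pi * (1/256)) * ((p + 1) * Gamma (p + 1)) / (2 * pi) powr (p + 1) + 2 * 290 powr (p + 1)) / (p + 1)
     = 2 * exp (2 * pi * (1/256)) * Gamma (p + 1) / (2 * pi) powr (p + 1) + 2 * 290 powr (p + 1) / (p + 1)"
    using p by (simp add: add_divide_distrib)
  also have "2 * exp (2 * pi * (1/256)) * Gamma (p + 1) / (2 * pi) powr (p + 1)
      \<le> 99/100 * (sqrt p * (p / (2 * pi * exp 1)) powr p)"
  proof -
    have "2 * exp (2 * pi * (1/256)) * Gamma (p + 1) / (2 * pi) powr (p + 1)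
       \<le> 2 * exp (1/40) * (exp (11/10) * (sqrt p * (p / exp 1) powr p)) / (2 * pi) powr (p + 1)"
      using pi_approx p Gamma_le_Stirling[OF p]
      by (intro divide_right_mono mult_mono) (auto intro!: less_imp_le[OF Gamma_real_pos])
    also have "\<dots> = 2 * exp (9/8) * (sqrt p * (p / exp 1) powr p) / (2 * pi) powr (p + 1)"
      by (simp flip: exp_add mult.assoc)
    also have "\<dots> = exp (9/8) * (sqrt p * (p / (2 * pi * exp 1)) powr p) / pi"
    proof -
      have "p / (2 * pi * exp 1) = p / exp 1 / (2 * pi)" by simp
      then have "(p / (2 * pi * exp 1)) powr p = (p / exp 1) powr p / (2 * pi) powr p"
        using p by (simp only: powr_divide[of "p / exp 1" "2 * pi" p])
      moreover have "(2 * pi) powr (p + 1) = (2 * pi) powr p * (2 * pi)"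
        by (simp add: powr_add)
      ultimately show ?thesis by simp
    qed
    also have "\<dots> \<le> (99/100 * pi) * (sqrt p * (p / (2 * pi * exp 1)) powr p) / pi"
      using exp_nine_eighths_le p by (intro divide_right_mono mult_right_mono) auto
    finally show ?thesis by simp
  qed
  finally show ?thesis by simp
qed

section \<open>Negativity\<close>

theorem theorem2:
  "\<exists>P::real. P > 0 \<and>
     (\<forall>p a :: real. p > P \<longrightarrow> a > p / (2 * pi * exp 1) + 1 / (4 * pi * exp 1) * ln p + 1 \<longrightarrow>
        hurwitz_zeta (complex_of_real (- p)) a \<in> \<real> \<and>
        Re (hurwitz_zeta (complex_of_real (- p)) a) < 0)"
proof -
  define X :: "real \<Rightarrow> real" where "X = (\<lambda>p. p / (2 * pi * exp 1) + 1 / (4 * pi * exp 1) * ln p)"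
  have "filterlim X at_top at_top" unfolding X_def by real_asymp
  then have "eventually (\<lambda>p. X p \<ge> 1) at_top" by (simp add: filterlim_at_top)
  moreover note last_term_eventually_dominates[of 290]
  ultimately have "eventually (\<lambda>p. 1 \<le> X p \<and>
      99/100 * (sqrt p * (p / (2 * pi * exp 1)) powr p) + 2 * 290 powr (p + 1) / (p + 1) < X p powr p) at_top"
    unfolding X_def by (auto elim: eventually_elim2)
  then obtain P where P: "\<And>p. p \<ge> P \<Longrightarrow> 1 \<le> X p \<and>
      99/100 * (sqrt p * (p / (2 * pi * exp 1)) powr p) + 2 * 290 powr (p + 1) / (p + 1) < X p powr p"
    unfolding eventually_at_top_linorder by blast
  have "hurwitz_zeta (of_real (-p)) a \<in> \<real> \<and> Re (hurwitz_zeta (of_real (-p)) a) < 0"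
    if p: "p > max P 1" and a: "a > X p + 1" for p a
  proof
    have X1: "1 \<le> X p" using P[of p] p by simp
    show "hurwitz_zeta (of_real (-p)) a \<in> \<real>"
      using p a X1 by (intro hurwitz_zeta_real_at_real) auto
    \<comment> \<open>One term fewer than the whole shift, so that the sum over \<open>r < Suc n\<close> visibly has a last term.\<close>
    define n where "n = nat \<lfloor>a\<rfloor> - 2"
    define a0 where "a0 = a - real (Suc n)"
    have "2 \<le> \<lfloor>a\<rfloor>" using a X1 by linarith
    then have "real (Suc n) = of_int \<lfloor>a\<rfloor> - 1" unfolding n_def by linarith
    then have a0: "1 \<le> a0" "a0 \<le> 2" unfolding a0_def by linarith+
    have aeq: "a0 + real (Suc n) = a" by (simp add: a0_def)
    have s: "of_real (-p) \<noteq> (1::complex)" using p by (auto simp: complex_eq_iff)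
    have "hurwitz_zeta (of_real (-p)) a0 = hurwitz_zeta (of_real (-p)) (a0 + real (Suc n)) +
            (\<Sum>r<Suc n. of_real (a0 + real r) powr (- of_real (-p)))"
      using a0 s by (intro hurwitz_zeta_shift) auto
    also have "(\<Sum>r<Suc n. of_real (a0 + real r) powr (- of_real (-p))) =
                 (of_real (\<Sum>r<Suc n. (a0 + real r) powr p) :: complex)"
      using a0 unfolding of_real_sum by (intro sum.cong refl) (simp add: powr_of_real flip: of_real_add)
    finally have "Re (hurwitz_zeta (of_real (-p)) a) =
        Re (hurwitz_zeta (of_real (-p)) a0) - (\<Sum>r<Suc n. (a0 + real r) powr p)"
      unfolding aeq by simp
    also have "\<dots> \<le> norm (hurwitz_zeta (of_real (-p)) a0) - (a - 1) powr p"
    proof -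
      have "a - 1 = a0 + real n" by (simp add: a0_def)
      then have "(a - 1) powr p \<le> (\<Sum>r<Suc n. (a0 + real r) powr p)"
        by (simp add: sum_nonneg)
      then show ?thesis using complex_Re_le_cmod[of "hurwitz_zeta (of_real (-p)) a0"] by linarith
    qed
    also have "X p powr p < (a - 1) powr p"
      using a X1 p by (intro powr_less_mono2) auto
    then have "norm (hurwitz_zeta (of_real (-p)) a0) - (a - 1) powr p < 0"
      using norm_hurwitz_zeta_le[of p a0] a0 p P[of p] by linarith
    finally show "Re (hurwitz_zeta (of_real (-p)) a) < 0" .
  qed
  then show ?thesis
    by (intro exI[of _ "max P 1"]) (auto simp: X_def)
qed

end
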